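(* Let $n$ and $k$ be nonnegative integers with $k\leq n$. The Bruhat order and the secondary Bruhat order coincide on $\mathcal{A}(n,k)$ if and only if either $0\leq n\leq 5$, or $n\geq 6$ and $k\in\{0,1,2,n-2,n-1,n\}$.
   Context: For nonnegative integers $n,k$ with $k\leq n$, $\mathcal{A}(n,k)$ denotes the class of all $n\times n$ $(0,1)$-matrices all of whose row sums and column sums equal $k$. Bruhat order: for an $n\times n$ matrix $A=[a_{ij}]$ put $\sigma_{ij}(A)=\sum_{p=1}^{i}\sum_{q=1}^{j}a_{pq}$ for $1\leq i,j\leq n$. For $A,C\in\mathcal{A}(n,k)$, $A\preceq_B C$ means $\sigma_{ij}(A)\geq\sigma_{ij}(C)$ for all $1\leq i,j\leq n$. Secondary Bruhat order: let $I_2=\begin{bmatrix}1&0\\0&1\end{bmatrix}$ and $L_2=\begin{bmatrix}0&1\\1&0\end{bmatrix}$. An $L_2\to I_2$ interchange replaces a submatrix in rows $i<j$ and columns $p<q$ (not necessarily consecutive) that equals $L_2$ by $I_2$, leaving all other entries unchanged; it preserves row and column sums. For $A,C\in\mathcal{A}(n,k)$, $A\preceq_{\widehat{B}}C$ means that $C$ can be transformed into $A$ by a finite (possibly empty) sequence of $L_2\to I_2$ interchanges. The two orders coincide on $\mathcal{A}(n,k)$ if, for all $A,C\in\mathcal{A}(n,k)$, $A\preceq_B C$ if and only if $A\preceq_{\widehat{B}}C$. *)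

theory Defs
  imports "Jordan_Normal_Form.Matrix"
begin

text \<open>Matrix indices start at 0 here, so rows \<open>1, \<dots>, n\<close> of the usual convention are \<open>0, \<dots>, n - 1\<close>.\<close>

definition zero_one_class :: "nat \<Rightarrow> nat \<Rightarrow> nat mat set" where
  "zero_one_class n k = {A \<in> carrier_mat n n.
     (\<forall>i<n. \<forall>j<n. A $$ (i, j) \<in> {0, 1}) \<and>
     (\<forall>i<n. (\<Sum>j<n. A $$ (i, j)) = k) \<and>
     (\<forall>j<n. (\<Sum>i<n. A $$ (i, j)) = k)}"

text \<open>The arguments \<open>i\<close>, \<open>j\<close> count rows and columns: the sum is over the leading
  \<open>i \<times> j\<close> submatrix, hence the range \<open>1, \<dots>, n\<close> in the order below.\<close>

definition leading_sum :: "nat mat \<Rightarrow> nat \<Rightarrow> nat \<Rightarrow> nat" where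
  "leading_sum A i j = (\<Sum>p<i. \<Sum>q<j. A $$ (p, q))"

definition bruhat_le :: "nat \<Rightarrow> nat mat \<Rightarrow> nat mat \<Rightarrow> bool" where
  "bruhat_le n A C \<longleftrightarrow>
     (\<forall>i\<in>{1..n}. \<forall>j\<in>{1..n}. leading_sum A i j \<ge> leading_sum C i j)"

text \<open>\<open>L2_I2_interchange C A\<close>: the matrix \<open>A\<close> results from \<open>C\<close> by a single interchange.\<close>

definition L2_I2_interchange :: "nat mat \<Rightarrow> nat mat \<Rightarrow> bool" where
  "L2_I2_interchange C A \<longleftrightarrow>
     (\<exists>i j p q. i < j \<and> j < dim_row C \<and> p < q \<and> q < dim_col C \<and>
        C $$ (i, p) = 0 \<and> C $$ (i, q) = 1 \<and>
        C $$ (j, p) = 1 \<and> C $$ (j, q) = 0 \<and>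
        A = mat (dim_row C) (dim_col C)
              (\<lambda>rc. if rc \<in> {(i, p), (j, q)} then 1
                    else if rc \<in> {(i, q), (j, p)} then 0
                    else C $$ rc))"

text \<open>Intermediate matrices need no membership condition, since an interchange preserves
  size, entries in \<open>{0, 1}\<close>, and row and column sums.\<close>

definition secondary_bruhat_le :: "nat mat \<Rightarrow> nat mat \<Rightarrow> bool" where
  "secondary_bruhat_le A C \<longleftrightarrow> L2_I2_interchange\<^sup>*\<^sup>* C A"

definition bruhat_orders_coincide :: "nat \<Rightarrow> nat \<Rightarrow> bool" where
  "bruhat_orders_coincide n k \<longleftrightarrow>
     (\<forall>A\<in>zero_one_class n k. \<forall>C\<in>zero_one_class n k.
        bruhat_le n A C \<longleftrightarrow> secondary_bruhat_le A C)"

end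

theory Submission
  imports Defs
begin

text \<open>
  An interchange \<open>L2 \<rightarrow> I2\<close> in rows \<open>i < j\<close> and columns \<open>p < q\<close> raises the leading sums by one
  exactly on the rectangle \<open>i < r \<le> j\<close>, \<open>p < s \<le> q\<close>. Hence the secondary order is always contained
  in the Bruhat order, and the question is whether, for \<open>A \<prec> C\<close> in the Bruhat order, there is an
  \<open>L2\<close> in \<open>C\<close>, or an \<open>I2\<close> in \<open>A\<close>, whose rectangle lies where the leading sums of \<open>A\<close> strictly
  exceed those of \<open>C\<close> (a free rectangle). If so, \<open>C\<close> can be lowered or \<open>A\<close> raised, and induction
  on the total difference of the leading sums finishes.

  For \<open>k \<le> 2\<close> such a rectangle exists with its upper side in the first row \<open>f\<close> in which \<open>A\<close> and
  \<open>C\<close> differ. In that row choose \<open>a < c\<close> with a one of \<open>A\<close> only at \<open>a\<close>, a one of \<open>C\<close> only at \<open>c\<close>,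
  and no difference in between. Let \<open>j\<close> be the first later row where \<open>C\<close> has a one in columns
  \<open>a, \<dots>, c - 1\<close>. If no free rectangle is usable, then \<open>C\<close> has a one at \<open>(j, c)\<close> as well, which
  fills column \<open>c\<close>. Dually, the first later row \<open>j'\<close> where \<open>A\<close> has a one in columns
  \<open>a + 1, \<dots>, c\<close> has a one of \<open>A\<close> at \<open>(j', a)\<close>. Suppose \<open>j \<le> j'\<close>. Column \<open>a\<close> of \<open>A\<close> then has two
  ones from row \<open>f\<close> on, so column \<open>a\<close> of \<open>C\<close> has two ones below row \<open>f\<close>, and \<open>C\<close> has a one in
  columns \<open>a, \<dots>, c - 1\<close> below row \<open>j\<close>. In the next row where this happens column \<open>c\<close> is
  exhausted, and the surplus of \<open>A\<close> created in rows \<open>f\<close> and \<open>j'\<close> outweighs the single one of \<open>C\<close>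
  in row \<open>j\<close>; so this row gives a usable rectangle after all (\<open>blocking_order\<close>). Reversing the
  order of the columns exchanges the roles of \<open>A\<close> and \<open>C\<close> and settles \<open>j' < j\<close>.

  Complementing all entries reverses both orders, which gives \<open>n - k \<le> 2\<close>.

  For \<open>3 \<le> k \<le> n - 3\<close> take a \<open>k\<close>-regular \<open>C\<close> whose leading \<open>4 \<times> 4\<close> submatrix has the rows \<open>0001\<close>,
  \<open>1101\<close>, \<open>1011\<close>, \<open>1000\<close>. Let \<open>A\<close> arise from it by the interchange at the four outer corners
  followed by the reverse interchange at the central \<open>2 \<times> 2\<close> block. The leading sums of \<open>A\<close> and \<open>C\<close>
  differ exactly on a \<open>3 \<times> 3\<close> square without its centre, and no \<open>L2\<close> of \<open>C\<close> has its rectangle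
  inside this ring. That the four rows extend to a regular matrix is a Ryser-type statement,
  proved by adding rows greedily (\<open>regular_completion\<close>).
\<close>

section \<open>Prefix sums and pairs of comparable matrices\<close>

definition psum :: "(nat \<Rightarrow> nat \<Rightarrow> int) \<Rightarrow> nat \<Rightarrow> nat \<Rightarrow> int" where
  "psum X i j = (\<Sum>p<i. \<Sum>q<j. X p q)"

lemma psum_diff_window:
  assumes "y \<le> z"
  shows "psum X r z = psum X r y + (\<Sum>p<r. \<Sum>q\<in>{y..<z}. X p q)"
proof -
  have "(\<Sum>q<z. X p q) = (\<Sum>q<y. X p q) + (\<Sum>q\<in>{y..<z}. X p q)" for p
    using sum.atLeastLessThan_concat[of 0 y z "X p"] assms by (simp add: atLeast0LessThan)
  then show ?thesis
    by (simp add: psum_def sum.distrib)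
qed

text \<open>The setting for \<open>k \<le> 2\<close>, for rectangular matrices with line sums that may differ from line to
  line. The last assumption is the Bruhat comparison of \<open>A\<close> with \<open>C\<close>.\<close>

locale balanced_pair =
  fixes n m :: nat and A C :: "nat \<Rightarrow> nat \<Rightarrow> int"
  assumes A01: "p < n \<Longrightarrow> q < m \<Longrightarrow> A p q \<in> {0, 1}"
    and C01: "p < n \<Longrightarrow> q < m \<Longrightarrow> C p q \<in> {0, 1}"
    and row_eq: "p < n \<Longrightarrow> (\<Sum>q<m. A p q) = (\<Sum>q<m. C p q)"
    and row_le: "p < n \<Longrightarrow> (\<Sum>q<m. C p q) \<le> 2"
    and col_eq: "q < m \<Longrightarrow> (\<Sum>p<n. A p q) = (\<Sum>p<n. C p q)"
    and col_le: "q < m \<Longrightarrow> (\<Sum>p<n. C p q) \<le> 2"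
    and dominated: "i \<le> n \<Longrightarrow> j \<le> m \<Longrightarrow> psum C i j \<le> psum A i j"

text \<open>The rectangle of leading sums affected by an interchange in rows \<open>i < j\<close> and columns \<open>p < q\<close>.
  The arguments of \<^const>\<open>psum\<close> count rows and columns, so row \<open>i\<close> is included from \<open>r = i + 1\<close> on.\<close>

definition free_rectangle ::
    "(nat \<Rightarrow> nat \<Rightarrow> int) \<Rightarrow> (nat \<Rightarrow> nat \<Rightarrow> int) \<Rightarrow> nat \<Rightarrow> nat \<Rightarrow> nat \<Rightarrow> nat \<Rightarrow> bool" where
  "free_rectangle A C i j p q \<longleftrightarrow>
     (\<forall>r y. i < r \<longrightarrow> r \<le> j \<longrightarrow> p < y \<longrightarrow> y \<le> q \<longrightarrow> psum C r y < psum A r y)"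

lemma free_rectangleI:
  "(\<And>r y. i < r \<Longrightarrow> r \<le> j \<Longrightarrow> p < y \<Longrightarrow> y \<le> q \<Longrightarrow> psum C r y < psum A r y)
    \<Longrightarrow> free_rectangle A C i j p q"
  by (simp add: free_rectangle_def)

lemma free_rectangle_mono:
  "free_rectangle A C i j p q \<Longrightarrow> j' \<le> j \<Longrightarrow> p \<le> p' \<Longrightarrow> q' \<le> q
    \<Longrightarrow> free_rectangle A C i j' p' q'"
  by (auto simp: free_rectangle_def)

definition has_L2 :: "(nat \<Rightarrow> nat \<Rightarrow> int) \<Rightarrow> nat \<Rightarrow> nat \<Rightarrow> nat \<Rightarrow> nat \<Rightarrow> bool" where
  "has_L2 X i j p q \<longleftrightarrow> X i p = 0 \<and> X i q = 1 \<and> X j p = 1 \<and> X j q = 0"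

definition has_I2 :: "(nat \<Rightarrow> nat \<Rightarrow> int) \<Rightarrow> nat \<Rightarrow> nat \<Rightarrow> nat \<Rightarrow> nat \<Rightarrow> bool" where
  "has_I2 X i j p q \<longleftrightarrow> X i p = 1 \<and> X i q = 0 \<and> X j p = 0 \<and> X j q = 1"

text \<open>Row \<open>f\<close> is the first row of difference, and \<open>a\<close>, \<open>c\<close> carry two consecutive nonzero entries of
  \<open>A - C\<close> in this row, in the order \<open>1\<close>, \<open>-1\<close>.\<close>

locale sign_change = balanced_pair +
  fixes f a c :: nat
  assumes f_less: "f < n"
    and above: "p < f \<Longrightarrow> q < m \<Longrightarrow> A p q = C p q"
    and a_less: "a < c" and c_less: "c < m"
    and Aa: "A f a = 1" and Ca: "C f a = 0" and Ac: "A f c = 0" and Cc: "C f c = 1"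
    and between: "a < y \<Longrightarrow> y < c \<Longrightarrow> A f y = C f y"
begin

lemma A_nonneg: "p < n \<Longrightarrow> q < m \<Longrightarrow> 0 \<le> A p q"
  using A01 by fastforce

lemma C_nonneg: "p < n \<Longrightarrow> q < m \<Longrightarrow> 0 \<le> C p q"
  using C01 by fastforce

text \<open>The difference of the prefix sums at column \<open>a\<close> is nonnegative, row \<open>f\<close> contributes one to the
  window \<open>a, \<dots>, y - 1\<close>, and the rows above contribute nothing. This is how all free rectangles below
  row \<open>f\<close> are found.\<close>

lemma window_bound:
  assumes "a < y" "y \<le> c" "f < r" "r \<le> n"
  shows "psum A r y - psum C r y \<ge> 1 + (\<Sum>p\<in>{f<..<r}. \<Sum>q\<in>{a..<y}. A p q)
      - (\<Sum>p\<in>{f<..<r}. \<Sum>q\<in>{a..<y}. C p q)"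
proof -
  let ?E = "\<lambda>p. \<Sum>q\<in>{a..<y}. A p q - C p q"
  have rows: "{..<r} = {..<f} \<union> insert f {f<..<r}" using assms by auto
  have cols: "{a..<y} = insert a {a<..<y}" using assms by auto
  have "?E f = (A f a - C f a) + (\<Sum>q\<in>{a<..<y}. A f q - C f q)"
    unfolding cols by simp
  also have "(\<Sum>q\<in>{a<..<y}. A f q - C f q) = 0"
    using between assms by (intro sum.neutral) auto
  finally have f: "?E f = 1" by (simp add: Aa Ca)
  have z: "(\<Sum>p<f. ?E p) = 0"
    using above assms c_less by (intro sum.neutral ballI) (simp add: sum.neutral)
  have "(\<Sum>p<r. ?E p) = (\<Sum>p<f. ?E p) + (?E f + (\<Sum>p\<in>{f<..<r}. ?E p))"
    unfolding rows by (subst sum.union_disjoint) auto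
  then have "(\<Sum>p<r. ?E p) = 1 + (\<Sum>p\<in>{f<..<r}. ?E p)"
    using f z by simp
  moreover have "psum C r a \<le> psum A r a"
    using dominated assms a_less c_less by simp
  ultimately show ?thesis
    using psum_diff_window[of a y A r] psum_diff_window[of a y C r] assms
    by (simp add: sum_subtractf)
qed

lemma free_above_first:
  assumes "f < j" "j \<le> n" "b \<le> c" "\<And>p q. f < p \<Longrightarrow> p < j \<Longrightarrow> a \<le> q \<Longrightarrow> q < b \<Longrightarrow> C p q = 0"
  shows "free_rectangle A C f j a b"
proof (rule free_rectangleI)
  fix r y assume *: "f < r" "r \<le> j" "a < y" "y \<le> b"
  have "(\<Sum>p\<in>{f<..<r}. \<Sum>q\<in>{a..<y}. C p q) = 0"
    using * assms by (intro sum.neutral ballI) auto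
  moreover have "(\<Sum>p\<in>{f<..<r}. \<Sum>q\<in>{a..<y}. A p q) \<ge> 0"
    using * assms c_less by (intro sum_nonneg A_nonneg) auto
  ultimately show "psum C r y < psum A r y"
    using window_bound[of y r] * assms by linarith
qed

lemma col_split:
  fixes X :: "nat \<Rightarrow> nat \<Rightarrow> int"
  shows "(\<Sum>p<n. X p q) = (\<Sum>p<f. X p q) + X f q + (\<Sum>p\<in>{f<..<n}. X p q)"
proof -
  have rows: "{..<n} = {..<f} \<union> insert f {f<..<n}" using f_less by auto
  show ?thesis unfolding rows by (subst sum.union_disjoint) auto
qed

text \<open>Column \<open>a\<close> has the same sum in both matrices, and \<open>C\<close> still owes the one that \<open>A\<close> has in row \<open>f\<close>.\<close>

lemma column_a_excess:
  "(\<Sum>p\<in>{f<..<n}. C p a) = 1 + (\<Sum>p\<in>{f<..<n}. A p a)"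
proof -
  have "(\<Sum>p<f. A p a) = (\<Sum>p<f. C p a)"
    using above a_less c_less by (intro sum.cong) auto
  then show ?thesis
    using col_split[of A a] col_split[of C a] col_eq[of a] a_less c_less Aa Ca by simp
qed

lemma one_in_other_row:
  assumes "finite P" "P \<subseteq> {f<..<n}" "q < m" "(\<Sum>p\<in>{f<..<n}. C p q) > int (card P)"
  obtains r where "f < r" "r < n" "r \<notin> P" "C r q = 1"
proof (rule ccontr)
  assume no: "\<not> thesis"
  have "C r q \<noteq> 1" if "r \<in> {f<..<n} - P" for r
    using \<open>\<And>r. f < r \<Longrightarrow> r < n \<Longrightarrow> r \<notin> P \<Longrightarrow> C r q = 1 \<Longrightarrow> thesis\<close>[of r] no that by auto
  then have nz: "C r q = 0" if "r \<in> {f<..<n} - P" for r using that C01[of r q] assms(3) by auto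
  have "(\<Sum>p\<in>{f<..<n}. C p q) = (\<Sum>p\<in>P. C p q)"
    using nz assms(2) by (intro sum.mono_neutral_right) auto
  also have "\<dots> \<le> (\<Sum>p\<in>P. 1)"
    using assms(2,3) C01 by (intro sum_mono) (metis greaterThanLessThan_iff insert_iff order_refl singletonD subsetD zero_le_one)
  finally show False using assms(4) by simp
qed

lemma col_two:
  assumes "q < m" "r < n" "s < n" "r \<noteq> s" "C r q = 1" "C s q = 1" "t < n" "t \<noteq> r" "t \<noteq> s"
  shows "C t q = 0"
proof (rule ccontr)
  assume "C t q \<noteq> 0"
  then have t: "C t q = 1" using C01[of t q] assms by auto
  have "(\<Sum>p\<in>{r,s,t}. C p q) \<le> (\<Sum>p<n. C p q)"
    using assms C_nonneg by (intro sum_mono2) auto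
  then show False using col_le[of q] assms t by simp
qed

lemma row_two:
  assumes "r < n" "q < m" "q' < m" "q \<noteq> q'" "C r q = 1" "C r q' = 1" "t < m" "t \<noteq> q" "t \<noteq> q'"
  shows "C r t = 0"
proof (rule ccontr)
  assume "C r t \<noteq> 0"
  then have t: "C r t = 1" using C01[of r t] assms by auto
  have "(\<Sum>p\<in>{q,q',t}. C r p) \<le> (\<Sum>p<m. C r p)"
    using assms C_nonneg by (intro sum_mono2) auto
  then show False using row_le[of r] assms t by simp
qed

lemma first_row_below:
  assumes "g < r" "r < n" "C r a = 1" "a < b" "b \<le> c"
  obtains j q where "g < j" "j < n" "a \<le> q" "q < b" "C j q = 1"
    "\<And>p t. g < p \<Longrightarrow> p < j \<Longrightarrow> a \<le> t \<Longrightarrow> t < b \<Longrightarrow> C p t = 0"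
proof -
  let ?P = "\<lambda>r. g < r \<and> r < n \<and> (\<exists>q. a \<le> q \<and> q < b \<and> C r q = 1)"
  define j where "j = (LEAST r. ?P r)"
  have "\<exists>r. ?P r" using assms by blast
  then have j: "?P j" unfolding j_def by (rule LeastI_ex)
  have "C p t = 0" if "g < p" "p < j" "a \<le> t" "t < b" for p t
  proof -
    have "\<not> ?P p" using that(2) unfolding j_def by (rule not_less_Least)
    then show ?thesis using that j C01[of p t] assms(5) c_less by auto
  qed
  then show thesis using that j by blast
qed

lemma one_in_col_a:
  obtains r where "f < r" "r < n" "C r a = 1"
proof -
  have "(\<Sum>p\<in>{f<..<n}. A p a) \<ge> 0"
    using a_less c_less by (intro sum_nonneg A_nonneg) auto
  then show ?thesis
    using one_in_other_row[of "{}" a] column_a_excess a_less c_less that by auto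
qed

text \<open>No interchange of \<open>C\<close> with upper row \<open>f\<close> stays above \<open>A\<close> in the Bruhat order.\<close>

definition stuck :: bool where
  "stuck \<longleftrightarrow> (\<forall>j p q. f < j \<longrightarrow> j < n \<longrightarrow> p < q \<longrightarrow> q < m \<longrightarrow> has_L2 C f j p q \<longrightarrow>
      \<not> free_rectangle A C f j p q)"

text \<open>A row that prevents the interchange with the one of \<open>C\<close> at \<open>(f, c)\<close>: it is reached before any
  other row with a one in the columns \<open>a, \<dots>, c - 1\<close>, but its entry in column \<open>c\<close> is a one too.\<close>

definition blocking :: "nat \<Rightarrow> bool" where
  "blocking j \<longleftrightarrow> f < j \<and> j < n \<and> C j c = 1 \<and> (\<forall>p q. f < p \<longrightarrow> p < j \<longrightarrow> a \<le> q \<longrightarrow> q < c \<longrightarrow> C p q = 0)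
    \<and> free_rectangle A C f j a c"

context
  assumes stuck: stuck
begin

lemma no_move: "f < j \<Longrightarrow> j < n \<Longrightarrow> p < q \<Longrightarrow> q < m \<Longrightarrow> C f p = 0 \<Longrightarrow> C f q = 1 \<Longrightarrow>
      C j p = 1 \<Longrightarrow> C j q = 0 \<Longrightarrow> \<not> free_rectangle A C f j p q"
  using stuck unfolding stuck_def has_L2_def by blast


text \<open>A one of \<open>C\<close> below row \<open>f\<close> is useless for an interchange with \<open>(f, c)\<close> if row \<open>f\<close> has a one in the
  same column \<open>p\<close>. In that case the interchange with \<open>(f, p)\<close>, for the first later row with a one in
  columns \<open>a, \<dots>, p - 1\<close>, can only fail because this row has the second one of column \<open>p\<close>. So it is the
  given row, and its one to the left of \<open>p\<close> is in a column where row \<open>f\<close> has a zero.\<close>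

lemma one_missing_in_row_f:
  assumes "f < r" "r < n" "a \<le> p" "p < c" "C r p = 1"
  shows "\<exists>p'. a \<le> p' \<and> p' < c \<and> C r p' = 1 \<and> C f p' = 0"
proof (cases "C f p = 0")
  case True
  then show ?thesis using assms by blast
next
  case False
  then have fp: "C f p = 1" using C01[of f p] f_less assms c_less by auto
  then have ap: "a < p" using Ca assms by (cases "a = p") auto
  obtain j q where j: "f < j" "j < n" "a \<le> q" "q < p" "C j q = 1"
    and z: "\<And>s t. f < s \<Longrightarrow> s < j \<Longrightarrow> a \<le> t \<Longrightarrow> t < p \<Longrightarrow> C s t = 0"
    using one_in_col_a first_row_below[of f _ p] ap assms by (metis less_imp_le)
  have fq: "C f q = 0"
    using row_two[of f p c q] fp Cc f_less j assms c_less by auto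
  have "free_rectangle A C f j q p"
    using free_above_first[of j p] z j assms free_rectangle_mono by (meson less_imp_le order_refl)
  then have "C j p \<noteq> 0" using no_move[of j q p] j fq fp assms c_less by auto
  then have "C j p = 1" using C01[of j p] j assms c_less by auto
  then have "r = j" using col_two[of p f j r] j fp assms f_less c_less by auto
  then show ?thesis using j fq assms by auto
qed

lemma blocking_exists: "\<exists>j. blocking j"
proof -
  obtain j q where j: "f < j" "j < n" "a \<le> q" "q < c" "C j q = 1"
    and z: "\<And>s t. f < s \<Longrightarrow> s < j \<Longrightarrow> a \<le> t \<Longrightarrow> t < c \<Longrightarrow> C s t = 0"
    using one_in_col_a first_row_below[of f _ c] a_less by (metis order_refl)
  obtain p where p: "a \<le> p" "p < c" "C j p = 1" "C f p = 0" using one_missing_in_row_f j by blast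
  have fr: "free_rectangle A C f j a c" using free_above_first[of j c] z j by auto
  then have "free_rectangle A C f j p c" using p free_rectangle_mono by blast
  then have "C j c \<noteq> 0" using no_move[of j p c] j p Cc c_less by auto
  then have "C j c = 1" using C01[of j c] j c_less by auto
  then show ?thesis unfolding blocking_def using j z fr by blast
qed

text \<open>The heart of the argument. A second one of \<open>A\<close> in column \<open>a\<close>, in a row \<open>j'\<close> not above the blocking
  row \<open>j\<close>, compensates for the one of \<open>C\<close> in row \<open>j\<close>. The next row \<open>j2\<close> of \<open>C\<close> with a one in the window
  then still spans a free rectangle with row \<open>f\<close>, and cannot have a one in column \<open>c\<close>.\<close>

lemma blocking_order:
  assumes "blocking j" and j': "f < j'" "j' < n" "A j' a = 1" "free_rectangle A C f j' a c"
  shows "j' < j"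
proof (rule ccontr)
  assume "\<not> j' < j"
  then have le: "j \<le> j'" by simp
  have j: "f < j" "j < n" "C j c = 1" and z: "\<And>p q. f < p \<Longrightarrow> p < j \<Longrightarrow> a \<le> q \<Longrightarrow> q < c \<Longrightarrow> C p q = 0"
    using assms(1) unfolding blocking_def by auto
  have "(\<Sum>p\<in>{j'}. A p a) \<le> (\<Sum>p\<in>{f<..<n}. A p a)"
    using j' a_less c_less by (intro sum_mono2 A_nonneg) auto
  then have "(\<Sum>p\<in>{f<..<n}. C p a) \<ge> 2" using column_a_excess j' by simp
  then obtain r where r: "f < r" "r < n" "r \<noteq> j" "C r a = 1"
    using one_in_other_row[of "{j}" a] j a_less c_less by auto
  have "\<not> r < j" using z[of r a] r a_less by auto
  then have "j < r" using r by auto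
  then obtain j2 q where j2: "j < j2" "j2 < n" "a \<le> q" "q < c" "C j2 q = 1"
    and z2: "\<And>s t. j < s \<Longrightarrow> s < j2 \<Longrightarrow> a \<le> t \<Longrightarrow> t < c \<Longrightarrow> C s t = 0"
    using first_row_below[of j r c] r a_less by (metis order_refl)
  obtain p where p: "a \<le> p" "p < c" "C j2 p = 1" "C f p = 0" using one_missing_in_row_f j2 j
    by (metis less_trans)
  have c0: "C j2 c = 0" using col_two[of c f j j2] Cc j j2 f_less c_less by auto
  have "free_rectangle A C f j2 a c"
  proof (rule free_rectangleI)
    fix r y assume *: "f < r" "r \<le> j2" "a < y" "y \<le> c"
    show "psum C r y < psum A r y"
    proof (cases "r \<le> j'")
      case True
      then show ?thesis using j' * unfolding free_rectangle_def by auto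
    next
      case False
      have rown: "(\<Sum>q\<in>{a..<y}. A p q) \<ge> 0" if "p < n" for p
        using that * c_less by (intro sum_nonneg A_nonneg) auto
      \<comment> \<open>Row \<open>j'\<close> of \<open>A\<close> contributes at least one to the window.\<close>
      have "1 \<le> (\<Sum>q\<in>{a}. A j' q)" using j' by simp
      also have "\<dots> \<le> (\<Sum>q\<in>{a..<y}. A j' q)"
        using j' * c_less by (intro sum_mono2 A_nonneg) auto
      also have "\<dots> = (\<Sum>p\<in>{j'}. \<Sum>q\<in>{a..<y}. A p q)" by simp
      also have "\<dots> \<le> (\<Sum>p\<in>{f<..<r}. \<Sum>q\<in>{a..<y}. A p q)"
        using j' False * j2 by (intro sum_mono2 rown) auto
      finally have 1: "1 \<le> (\<Sum>p\<in>{f<..<r}. \<Sum>q\<in>{a..<y}. A p q)" .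
      \<comment> \<open>Only row \<open>j\<close> of \<open>C\<close> meets the window, and only once since \<open>(j, c)\<close> is its other one.\<close>
      have "(\<Sum>p\<in>{f<..<r}. \<Sum>q\<in>{a..<y}. C p q) = (\<Sum>p\<in>{j}. \<Sum>q\<in>{a..<y}. C p q)"
      proof (rule sum.mono_neutral_right)
        show "\<forall>i\<in>{f<..<r} - {j}. (\<Sum>q\<in>{a..<y}. C i q) = 0"
        proof (intro ballI sum.neutral)
          fix i q assume "i \<in> {f<..<r} - {j}" "q \<in> {a..<y}"
          then show "C i q = 0" using z[of i q] z2[of i q] * by (cases "i < j") auto
        qed
      qed (use j False le in auto)
      also have "\<dots> + C j c = (\<Sum>q\<in>insert c {a..<y}. C j q)" using * by simp
      also have "\<dots> \<le> (\<Sum>q<m. C j q)"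
        using j * c_less by (intro sum_mono2 C_nonneg) auto
      finally have "(\<Sum>p\<in>{f<..<r}. \<Sum>q\<in>{a..<y}. C p q) \<le> 1"
        using row_le[of j] j by simp
      then show ?thesis using 1 window_bound[of y r] * j2 by linarith
    qed
  qed
  then have "free_rectangle A C f j2 p c" using p free_rectangle_mono by blast
  then show False using no_move[of j2 p c] p j j2 Cc c0 c_less by auto
qed

end

end

section \<open>A free rectangle at the first row of difference\<close>

text \<open>Reversing the columns reverses the Bruhat order, because the full row sums of \<open>A\<close> and \<open>C\<close> agree.
  An \<open>I2\<close> of \<open>A\<close> becomes an \<open>L2\<close> of its mirror image, and the ones at \<open>a\<close> and \<open>c\<close> swap places. So all
  results on \<open>C\<close> have dual versions for \<open>A\<close>.\<close>

definition mirror :: "nat \<Rightarrow> (nat \<Rightarrow> nat \<Rightarrow> int) \<Rightarrow> nat \<Rightarrow> nat \<Rightarrow> int" where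
  "mirror m X p q = X p (m - Suc q)"

lemma psum_mirror:
  assumes "y \<le> m"
  shows "psum (mirror m X) r y = psum X r m - psum X r (m - y)"
proof -
  have "(\<Sum>q<y. X p (m - Suc q)) = (\<Sum>q\<in>{m - y..<m}. X p q)" for p
    by (rule sum.reindex_bij_witness[of _ "\<lambda>q. m - Suc q" "\<lambda>q. m - Suc q"])
      (use assms in auto)
  then have "psum (mirror m X) r y = (\<Sum>p<r. \<Sum>q\<in>{m - y..<m}. X p q)"
    by (simp add: psum_def mirror_def)
  then show ?thesis
    using psum_diff_window[of "m - y" m X r] by simp
qed

lemma (in balanced_pair) psum_full_rows: "r \<le> n \<Longrightarrow> psum A r m = psum C r m"
  unfolding psum_def by (rule sum.cong) (simp_all add: row_eq)

lemma (in balanced_pair) psum_mirror_diff: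
  "r \<le> n \<Longrightarrow> y \<le> m \<Longrightarrow> psum (mirror m C) r y - psum (mirror m A) r y
    = psum A r (m - y) - psum C r (m - y)"
  by (simp add: psum_mirror psum_full_rows)

lemma (in balanced_pair) mirror_balanced: "balanced_pair n m (mirror m C) (mirror m A)"
proof
  fix p q assume "p < n" "q < m"
  then show "mirror m C p q \<in> {0, 1}" "mirror m A p q \<in> {0, 1}"
    using A01[of p "m - Suc q"] C01[of p "m - Suc q"] by (auto simp: mirror_def)
next
  have rev: "(\<Sum>q<m. mirror m X p q) = (\<Sum>q<m. X p q)" for X p
    unfolding mirror_def by (rule sum.nat_diff_reindex)
  fix p assume "p < n"
  then show "(\<Sum>q<m. mirror m C p q) = (\<Sum>q<m. mirror m A p q)"
    "(\<Sum>q<m. mirror m A p q) \<le> 2"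
    using row_eq row_le by (simp_all add: rev)
next
  fix q assume "q < m"
  then show "(\<Sum>p<n. mirror m C p q) = (\<Sum>p<n. mirror m A p q)"
    "(\<Sum>p<n. mirror m A p q) \<le> 2"
    using col_eq[of "m - Suc q"] col_le[of "m - Suc q"] by (simp_all add: mirror_def)
next
  fix i j assume "i \<le> n" "j \<le> m"
  then show "psum (mirror m A) i j \<le> psum (mirror m C) i j"
    using psum_mirror_diff[of i j] dominated[of i "m - j"] by simp
qed

lemma (in balanced_pair) free_rectangle_mirror:
  assumes "free_rectangle (mirror m C) (mirror m A) i j p q" "j \<le> n" "p < q" "q < m"
  shows "free_rectangle A C i j (m - Suc q) (m - Suc p)"
proof (rule free_rectangleI)
  fix r y assume *: "i < r" "r \<le> j" "m - Suc q < y" "y \<le> m - Suc p"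
  then have "psum (mirror m A) r (m - y) < psum (mirror m C) r (m - y)"
    using assms unfolding free_rectangle_def by auto
  then show "psum C r y < psum A r y"
    using psum_mirror_diff[of r "m - y"] * assms by simp
qed

lemma (in sign_change) mirror_sign_change:
  "sign_change n m (mirror m C) (mirror m A) f (m - Suc c) (m - Suc a)"
proof -
  interpret M: balanced_pair n m "mirror m C" "mirror m A" by (rule mirror_balanced)
  show ?thesis
  proof
    fix y assume y: "m - Suc c < y" "y < m - Suc a"
    then have "A f (m - Suc y) = C f (m - Suc y)"
      using c_less a_less by (intro between) auto
    then show "mirror m C f y = mirror m A f y" by (simp add: mirror_def)
  qed (use f_less above a_less c_less Aa Ca Ac Cc in \<open>auto simp: mirror_def\<close>)
qed

text \<open>If neither matrix admits a move, each of them has a blocking row, and \<open>blocking_order\<close> applied to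
  the pair and to its mirror image places each of the two rows strictly above the other.\<close>

lemma (in sign_change) step_at_first_row:
  "\<exists>j p q. f < j \<and> j < n \<and> p < q \<and> q < m \<and> free_rectangle A C f j p q \<and>
     (has_L2 C f j p q \<or> has_I2 A f j p q)"
proof (rule ccontr)
  assume none: "\<not> ?thesis"
  interpret M: sign_change n m "mirror m C" "mirror m A" f "m - Suc c" "m - Suc a"
    by (rule mirror_sign_change)
  have stuck unfolding stuck_def using none by blast
  have M.stuck unfolding M.stuck_def
  proof (intro allI impI notI)
    fix j p q assume *: "f < j" "j < n" "p < q" "q < m" "has_L2 (mirror m A) f j p q"
      "free_rectangle (mirror m C) (mirror m A) f j p q"
    then have "free_rectangle A C f j (m - Suc q) (m - Suc p)"
      by (intro free_rectangle_mirror) auto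
    moreover have "has_I2 A f j (m - Suc q) (m - Suc p)"
      using * by (simp add: has_I2_def has_L2_def mirror_def)
    moreover have "m - Suc q < m - Suc p" "m - Suc p < m" using * by auto
    ultimately show False using none * by blast
  qed
  obtain j where j: "blocking j" using blocking_exists[OF \<open>stuck\<close>] by blast
  obtain j' where j': "M.blocking j'" using M.blocking_exists[OF \<open>M.stuck\<close>] by blast
  have a: "m - Suc (m - Suc a) = a" and c: "m - Suc (m - Suc c) = c"
    using a_less c_less by auto
  have "f < j'" "j' < n" "A j' a = 1" "free_rectangle A C f j' a c"
    using j' free_rectangle_mirror[of f j' "m - Suc c" "m - Suc a"] a_less c_less
    unfolding M.blocking_def by (auto simp: mirror_def a c)
  then have "j' < j" using blocking_order[OF \<open>stuck\<close> j] by blast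
  have "f < j" "j < n" "mirror m C j (m - Suc c) = 1"
      and fr: "free_rectangle A C f j a c"
    using j a_less c_less unfolding blocking_def by (auto simp: mirror_def c)
  moreover have "free_rectangle (mirror m C) (mirror m A) f j (m - Suc c) (m - Suc a)"
  proof (rule free_rectangleI)
    fix r y assume *: "f < r" "r \<le> j" "m - Suc c < y" "y \<le> m - Suc a"
    then have "psum C r (m - y) < psum A r (m - y)"
      using fr a_less c_less unfolding free_rectangle_def by auto
    then show "psum (mirror m A) r y < psum (mirror m C) r y"
      using psum_mirror_diff[of r y] * \<open>j < n\<close> by linarith
  qed
  ultimately have "j < j'" using M.blocking_order[OF \<open>M.stuck\<close> j'] by blast
  with \<open>j' < j\<close> show False by simp
qed

text \<open>In the first row of difference the prefix sums of \<open>A - C\<close> are nonnegative, so its first negative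
  entry \<open>c\<close> is preceded by a positive one; \<open>a\<close> is the last of these before \<open>c\<close>.\<close>

lemma (in balanced_pair) sign_change_exists:
  assumes "p < n" "q < m" "A p q \<noteq> C p q"
  obtains f a c where "sign_change n m A C f a c"
proof -
  define f where "f = (LEAST p. \<exists>q<m. A p q \<noteq> C p q)"
  have "\<exists>q<m. A f q \<noteq> C f q" 
    unfolding f_def by (rule LeastI[of "\<lambda>p. \<exists>q<m. A p q \<noteq> C p q" p]) (use assms in blast)
  then obtain q0 where q0: "q0 < m" "A f q0 \<noteq> C f q0" by blast
  have "f \<le> p" unfolding f_def by (rule Least_le) (use assms in blast)
  then have f: "f < n" using assms by simp
  have above: "A r y = C r y" if "r < f" "y < m" for r y
    using not_less_Least[OF that(1)[unfolded f_def]] that(2) by blast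
  have "\<exists>y<m. A f y < C f y"
  proof (rule ccontr)
    assume "\<not> ?thesis"
    then have "\<forall>y\<in>{..<m}. C f y \<le> A f y" by auto
    moreover from this have "C f q0 < A f q0" using q0 by (simp add: order.strict_iff_order)
    ultimately have "(\<Sum>y<m. C f y) < (\<Sum>y<m. A f y)"
      using q0 by (intro sum_strict_mono_ex1) auto
    then show False using row_eq f by simp
  qed
  define c where "c = (LEAST y. y < m \<and> A f y < C f y)"
  have c: "c < m" "A f c < C f c"
    using LeastI_ex[OF \<open>\<exists>y<m. A f y < C f y\<close>] unfolding c_def by auto
  have least: "C f y \<le> A f y" if "y < c" for y
    using not_less_Least[OF that[unfolded c_def]] that c by auto
  have "\<exists>y<c. C f y < A f y"
  proof (rule ccontr)
    assume "\<not> ?thesis"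
    then have "A f y = C f y" if "y < c" for y
      using least[OF that] that by force
    then have eq: "(\<Sum>y<c. A f y) = (\<Sum>y<c. C f y)" by simp
    have "psum A f (Suc c) = psum C f (Suc c)"
      unfolding psum_def using above c by (intro sum.cong) auto
    moreover have "psum C (Suc f) (Suc c) \<le> psum A (Suc f) (Suc c)"
      using dominated f c by auto
    ultimately show False
      using eq c by (simp add: psum_def)
  qed
  then have ex: "\<exists>y. y < c \<and> C f y < A f y" .
  define a where "a = (GREATEST y. y < c \<and> C f y < A f y)"
  have a: "a < c" "C f a < A f a"
    using GreatestI_ex_nat[OF ex, of c] unfolding a_def by auto
  have "A f y = C f y" if "a < y" "y < c" for y
  proof -
    have "\<not> C f y < A f y"
      using Greatest_le_nat[of "\<lambda>y. y < c \<and> C f y < A f y" y c] that unfolding a_def by auto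
    then show ?thesis using least[OF that(2)] by simp
  qed
  moreover have "A f a = 1" "C f a = 0" "A f c = 0" "C f c = 1"
    using a c A01[of f a] A01[of f c] C01[of f a] C01[of f c] f by auto
  ultimately have "sign_change n m A C f a c"
    using f above a c by unfold_locales auto
  then show thesis using that by blast
qed

section \<open>Interchanges as rank-one perturbations\<close>

abbreviation entry :: "nat mat \<Rightarrow> nat \<Rightarrow> nat \<Rightarrow> int" where
  "entry A p q \<equiv> int (A $$ (p, q))"

lemma leading_sum_psum: "int (leading_sum A i j) = psum (entry A) i j"
  by (simp add: leading_sum_def psum_def)

lemma leading_sum_0 [simp]: "leading_sum A 0 j = 0" "leading_sum A i 0 = 0"
  by (simp_all add: leading_sum_def)

lemma bruhat_le_iff:
  "bruhat_le n A C \<longleftrightarrow> (\<forall>i\<le>n. \<forall>j\<le>n. leading_sum C i j \<le> leading_sum A i j)"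
  unfolding bruhat_le_def
proof (intro iffI allI impI ballI)
  fix i j assume h: "\<forall>i\<in>{1..n}. \<forall>j\<in>{1..n}. leading_sum C i j \<le> leading_sum A i j"
    and "i \<le> n" "j \<le> n"
  then show "leading_sum C i j \<le> leading_sum A i j"
    by (cases "i = 0 \<or> j = 0") auto
qed auto

text \<open>An interchange adds the rank-one matrix with entries \<open>bump i j r * bump p q s\<close>. Its prefix sums are
  the products of two indicator functions, and its row and column sums vanish.\<close>

definition bump :: "nat \<Rightarrow> nat \<Rightarrow> nat \<Rightarrow> int" where
  "bump i j r = of_bool (r = i) - of_bool (r = j)"

lemma sum_bump:
  assumes "i < j"
  shows "(\<Sum>r<t. bump i j r) = of_bool (i < t \<and> t \<le> j)"
proof -
  have "(\<Sum>r<t. of_bool (r = i) :: int) = of_bool (i < t)" for i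
    by (simp add: of_bool_def)
  then show ?thesis
    using assms by (auto simp: bump_def sum_subtractf)
qed

lemma psum_mult: "psum (\<lambda>p q. u p * v q) i j = (\<Sum>p<i. u p) * (\<Sum>q<j. v q)"
  by (simp add: psum_def sum_product)

lemma psum_add: "psum (\<lambda>p q. X p q + Y p q) i j = psum X i j + psum Y i j"
  by (simp add: psum_def sum.distrib)

lemma psum_cong:
  "(\<And>p q. p < i \<Longrightarrow> q < j \<Longrightarrow> X p q = Y p q) \<Longrightarrow> psum X i j = psum Y i j"
  unfolding psum_def by (intro sum.cong refl) auto

text \<open>The four entries affected by the interchange are fixed by \<^const>\<open>has_L2\<close> and the additive equation
  together. The equation can be summed, and read from \<open>A\<close> to \<open>C\<close> as well as from \<open>C\<close> to \<open>A\<close>.\<close>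

definition interchange_at :: "nat \<Rightarrow> nat \<Rightarrow> nat \<Rightarrow> nat \<Rightarrow> nat \<Rightarrow> nat mat \<Rightarrow> nat mat \<Rightarrow> bool" where
  "interchange_at n i j p q C A \<longleftrightarrow> i < j \<and> j < n \<and> p < q \<and> q < n \<and>
     has_L2 (entry C) i j p q \<and> C \<in> carrier_mat n n \<and> A \<in> carrier_mat n n \<and>
     (\<forall>r<n. \<forall>s<n. entry A r s = entry C r s + bump i j r * bump p q s)"

lemma interchange_atD:
  assumes "interchange_at n i j p q C A"
  shows "has_I2 (entry A) i j p q"
  using assms unfolding interchange_at_def has_L2_def has_I2_def bump_def by auto

lemma interchange_at_iff:
  assumes "C \<in> carrier_mat n n"
  shows "L2_I2_interchange C A \<longleftrightarrow> (\<exists>i j p q. interchange_at n i j p q C A)"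
proof
  assume "L2_I2_interchange C A"
  then obtain i j p q where *: "i < j" "j < n" "p < q" "q < n"
    "C $$ (i, p) = 0" "C $$ (i, q) = 1" "C $$ (j, p) = 1" "C $$ (j, q) = 0"
    and A: "A = mat n n (\<lambda>rc. if rc \<in> {(i, p), (j, q)} then 1
                    else if rc \<in> {(i, q), (j, p)} then 0 else C $$ rc)"
    using assms unfolding L2_I2_interchange_def by auto
  have "entry A r s = entry C r s + bump i j r * bump p q s" if "r < n" "s < n" for r s
    using * that unfolding A
    by (cases "r = i"; cases "r = j"; cases "s = p"; cases "s = q") (simp_all add: bump_def)
  then have "interchange_at n i j p q C A"
    using assms * A by (simp add: interchange_at_def has_L2_def)
  then show "\<exists>i j p q. interchange_at n i j p q C A" by blast
next
  assume "\<exists>i j p q. interchange_at n i j p q C A"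
  then obtain i j p q where *: "i < j" "j < n" "p < q" "q < n" "A \<in> carrier_mat n n"
    "has_L2 (entry C) i j p q"
    "\<And>r s. r < n \<Longrightarrow> s < n \<Longrightarrow> entry A r s = entry C r s + bump i j r * bump p q s"
    unfolding interchange_at_def by auto
  have L: "C $$ (i, p) = 0" "C $$ (i, q) = 1" "C $$ (j, p) = 1" "C $$ (j, q) = 0"
    using *(6) unfolding has_L2_def by auto
  have "A = mat n n (\<lambda>rc. if rc \<in> {(i, p), (j, q)} then 1
                    else if rc \<in> {(i, q), (j, p)} then 0 else C $$ rc)" (is "A = ?B")
  proof (rule eq_matI)
    fix r s assume "r < dim_row ?B" "s < dim_col ?B"
    then have rs: "r < n" "s < n" by auto
    have "int (A $$ (r, s)) = int (?B $$ (r, s))"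
      using *(7)[OF rs] L *(1,3) rs
      by (cases "r = i"; cases "r = j"; cases "s = p"; cases "s = q") (simp_all add: bump_def)
    then show "A $$ (r, s) = ?B $$ (r, s)" by simp
  qed (use * in auto)
  then show "L2_I2_interchange C A"
    unfolding L2_I2_interchange_def using * L assms by auto
qed

lemma interchange_leading_sum:
  assumes "interchange_at n i j p q C A" "r \<le> n" "s \<le> n"
  shows "int (leading_sum A r s)
    = int (leading_sum C r s) + of_bool (i < r \<and> r \<le> j \<and> p < s \<and> s \<le> q)"
proof -
  have "psum (entry A) r s = psum (\<lambda>x y. entry C x y + bump i j x * bump p q y) r s"
    using assms unfolding interchange_at_def by (intro psum_cong) auto
  also have "\<dots> = psum (entry C) r s + of_bool (i < r \<and> r \<le> j) * of_bool (p < s \<and> s \<le> q)"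
    using assms unfolding interchange_at_def by (simp add: psum_add psum_mult sum_bump)
  finally show ?thesis by (auto simp: leading_sum_psum)
qed

lemma zero_one_class_int:
  "A \<in> zero_one_class n k \<longleftrightarrow> A \<in> carrier_mat n n \<and>
     (\<forall>i<n. \<forall>j<n. entry A i j \<in> {0, 1}) \<and>
     (\<forall>i<n. (\<Sum>j<n. entry A i j) = int k) \<and>
     (\<forall>j<n. (\<Sum>i<n. entry A i j) = int k)"
  unfolding zero_one_class_def by (simp flip: of_nat_sum)

text \<open>The perturbation \<open>E\<close> is kept general so that an interchange and its reverse are both instances.\<close>

lemma zero_one_class_perturb:
  assumes C: "C \<in> zero_one_class n k" and A: "A \<in> carrier_mat n n"
    and eq: "\<And>r s. r < n \<Longrightarrow> s < n \<Longrightarrow> entry A r s = entry C r s + E r s"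
    and A01: "\<And>r s. r < n \<Longrightarrow> s < n \<Longrightarrow> entry A r s \<in> {0, 1}"
    and rows: "\<And>r. r < n \<Longrightarrow> (\<Sum>s<n. E r s) = 0" and cols: "\<And>s. s < n \<Longrightarrow> (\<Sum>r<n. E r s) = 0"
  shows "A \<in> zero_one_class n k"
proof -
  have "(\<Sum>s<n. entry A r s) = int k" if "r < n" for r
  proof -
    have "(\<Sum>s<n. entry A r s) = (\<Sum>s<n. entry C r s + E r s)"
      using eq that by (intro sum.cong) auto
    then show ?thesis using C rows that by (simp add: zero_one_class_int sum.distrib)
  qed
  moreover have "(\<Sum>r<n. entry A r s) = int k" if "s < n" for s
  proof -
    have "(\<Sum>r<n. entry A r s) = (\<Sum>r<n. entry C r s + E r s)"
      using eq that by (intro sum.cong) auto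
    then show ?thesis using C cols that by (simp add: zero_one_class_int sum.distrib)
  qed
  ultimately show ?thesis using A A01 by (simp add: zero_one_class_int)
qed

lemma bump_sums:
  assumes "i < j" "j < n" "p < q" "q < n"
  shows "(\<Sum>s<n. bump i j r * bump p q s) = 0" "(\<Sum>r<n. bump i j r * bump p q s) = 0"
  using assms by (simp_all add: sum_bump flip: sum_distrib_left sum_distrib_right)

lemma interchange_class_forward:
  assumes i: "interchange_at n i j p q C A" and C: "C \<in> zero_one_class n k"
  shows "A \<in> zero_one_class n k"
proof (rule zero_one_class_perturb[OF C, of _ "\<lambda>r s. bump i j r * bump p q s"])
  note * = i[unfolded interchange_at_def]
  show "A \<in> carrier_mat n n" using * by simp
  show eq: "entry A r s = entry C r s + bump i j r * bump p q s" if "r < n" "s < n" for r s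
    using * that by simp
  show "entry A r s \<in> {0, 1}" if "r < n" "s < n" for r s
  proof -
    have "entry C r s \<in> {0, 1}" using C that by (simp add: zero_one_class_int)
    moreover have "has_L2 (entry C) i j p q" "i < j" "p < q" using * by auto
    ultimately show ?thesis unfolding eq[OF that] has_L2_def
      by (cases "r = i"; cases "r = j"; cases "s = p"; cases "s = q") (simp_all add: bump_def)
  qed
qed (use i bump_sums[of i j n p q] in \<open>auto simp: interchange_at_def\<close>)

lemma interchange_class_backward:
  assumes i: "interchange_at n i j p q C A" and A: "A \<in> zero_one_class n k"
  shows "C \<in> zero_one_class n k"
proof (rule zero_one_class_perturb[OF A, of _ "\<lambda>r s. - (bump i j r * bump p q s)"])
  note * = i[unfolded interchange_at_def]
  show "C \<in> carrier_mat n n" using * by simp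
  show eq: "entry C r s = entry A r s + - (bump i j r * bump p q s)" if "r < n" "s < n" for r s
    using * that by simp
  show "entry C r s \<in> {0, 1}" if "r < n" "s < n" for r s
  proof -
    have "entry A r s \<in> {0, 1}" using A that by (simp add: zero_one_class_int)
    moreover have "i < j" "p < q" using * by auto
    ultimately show ?thesis using interchange_atD[OF i] unfolding eq[OF that] has_I2_def
      by (cases "r = i"; cases "r = j"; cases "s = p"; cases "s = q") (simp_all add: bump_def)
  qed
qed (use i bump_sums[of i j n p q] in \<open>auto simp: interchange_at_def sum_negf\<close>)

lemma secondary_imp_bruhat:
  assumes "C \<in> zero_one_class n k" "secondary_bruhat_le A C"
  shows "bruhat_le n A C \<and> A \<in> zero_one_class n k"
  using assms(2) unfolding secondary_bruhat_le_def
proof (induction rule: rtranclp_induct)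
  case base
  then show ?case using assms(1) by (simp add: bruhat_le_iff)
next
  case (step B A)
  then have "B \<in> carrier_mat n n" by (simp add: zero_one_class_def)
  then obtain i j p q where i: "interchange_at n i j p q B A"
    using step interchange_at_iff by blast
  then have "A \<in> zero_one_class n k" using step interchange_class_forward by blast
  moreover have "leading_sum B r s \<le> leading_sum A r s" if "r \<le> n" "s \<le> n" for r s
    using interchange_leading_sum[OF i that] by (auto simp: of_bool_def split: if_splits)
  ultimately show ?case
    using step.IH unfolding bruhat_le_iff by (meson order_trans)
qed

lemma interchange_up_exists:
  assumes C: "C \<in> carrier_mat n n" and *: "i < j" "j < n" "p < q" "q < n"
    and L2: "has_L2 (entry C) i j p q"
  obtains A where "interchange_at n i j p q C A"
proof -
  let ?A = "mat n n (\<lambda>(r, s). nat (entry C r s + bump i j r * bump p q s))"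
  have "0 \<le> entry C r s + bump i j r * bump p q s" for r s
    using *(1,3) L2 unfolding has_L2_def
    by (cases "r = i"; cases "r = j"; cases "s = p"; cases "s = q") (simp_all add: bump_def)
  then have "interchange_at n i j p q C ?A"
    using assms by (simp add: interchange_at_def)
  then show thesis by (rule that)
qed

lemma interchange_down_exists:
  assumes A: "A \<in> carrier_mat n n" and *: "i < j" "j < n" "p < q" "q < n"
    and I2: "has_I2 (entry A) i j p q"
  obtains C where "interchange_at n i j p q C A"
proof -
  let ?C = "mat n n (\<lambda>(r, s). nat (entry A r s - bump i j r * bump p q s))"
  have nn: "0 \<le> entry A r s - bump i j r * bump p q s" for r s
    using *(1,3) I2 unfolding has_I2_def
    by (cases "r = i"; cases "r = j"; cases "s = p"; cases "s = q") (simp_all add: bump_def)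
  have "has_L2 (entry ?C) i j p q"
    using * I2 by (simp add: has_L2_def has_I2_def bump_def)
  then have "interchange_at n i j p q ?C A"
    using assms nn by (simp add: interchange_at_def)
  then show thesis by (rule that)
qed

section \<open>Coincidence for line sums at most two\<close>

text \<open>Inside a free rectangle the leading sums have room for the change by one that the interchange
  makes there, and outside it they do not change.\<close>

lemma bruhat_step:
  assumes A: "A \<in> zero_one_class n k" and C: "C \<in> zero_one_class n k" and k: "k \<le> 2"
    and le: "bruhat_le n A C" and ne: "A \<noteq> C"
  shows "\<exists>i j p q. (\<exists>C'. interchange_at n i j p q C C' \<and> bruhat_le n A C') \<or>
      (\<exists>A'. interchange_at n i j p q A' A \<and> bruhat_le n A' C)"
proof -
  have cA: "A \<in> carrier_mat n n" and cC: "C \<in> carrier_mat n n"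
    using A C by (simp_all add: zero_one_class_def)
  interpret balanced_pair n n "entry A" "entry C"
    using A C k le unfolding zero_one_class_int bruhat_le_iff
    by unfold_locales (auto simp flip: leading_sum_psum)
  obtain r s where "r < n" "s < n" "A $$ (r, s) \<noteq> C $$ (r, s)"
    using ne cA cC by (metis carrier_matD eq_matI)
  then obtain f a c where "sign_change n n (entry A) (entry C) f a c"
    using sign_change_exists[of r s] by auto
  then interpret sign_change n n "entry A" "entry C" f a c .
  obtain j p q where *: "f < j" "j < n" "p < q" "q < n"
      and free: "free_rectangle (entry A) (entry C) f j p q"
      and or: "has_L2 (entry C) f j p q \<or> has_I2 (entry A) f j p q"
    using step_at_first_row by blast
  have strict: "leading_sum C r s < leading_sum A r s"
    if "f < r \<and> r \<le> j \<and> p < s \<and> s \<le> q" for r s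
    using free that unfolding free_rectangle_def leading_sum_psum[symmetric] by simp
  from or show ?thesis
  proof
    assume "has_L2 (entry C) f j p q"
    then obtain C' where C': "interchange_at n f j p q C C'"
      using interchange_up_exists cC * by blast
    have "leading_sum C' r s \<le> leading_sum A r s" if "r \<le> n" "s \<le> n" for r s
    proof -
      have "leading_sum C r s \<le> leading_sum A r s" using le that unfolding bruhat_le_iff by blast
      then show ?thesis
        using interchange_leading_sum[OF C' that] strict[of r s]
        by (cases "f < r \<and> r \<le> j \<and> p < s \<and> s \<le> q") (auto simp: of_bool_def)
    qed
    then show ?thesis using C' unfolding bruhat_le_iff by blast
  next
    assume "has_I2 (entry A) f j p q"
    then obtain A' where A': "interchange_at n f j p q A' A"
      using interchange_down_exists cA * by blast
    have "leading_sum C r s \<le> leading_sum A' r s" if "r \<le> n" "s \<le> n" for r s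
    proof -
      have "leading_sum C r s \<le> leading_sum A r s" using le that unfolding bruhat_le_iff by blast
      then show ?thesis
        using interchange_leading_sum[OF A' that] strict[of r s]
        by (cases "f < r \<and> r \<le> j \<and> p < s \<and> s \<le> q") (auto simp: of_bool_def)
    qed
    then show ?thesis using A' unfolding bruhat_le_iff by blast
  qed
qed

definition total_leading_sum :: "nat \<Rightarrow> nat mat \<Rightarrow> nat" where
  "total_leading_sum n A = (\<Sum>i\<le>n. \<Sum>j\<le>n. leading_sum A i j)"

lemma total_leading_sum_mono: "bruhat_le n A C \<Longrightarrow> total_leading_sum n C \<le> total_leading_sum n A"
  unfolding bruhat_le_iff total_leading_sum_def by (intro sum_mono) auto

lemma total_leading_sum_interchange:
  assumes "interchange_at n i j p q C A"
  shows "total_leading_sum n C < total_leading_sum n A"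
proof -
  have ij: "j < n" "q < n" "i < j" "p < q" using assms by (auto simp: interchange_at_def)
  have le: "leading_sum C r s \<le> leading_sum A r s" if "r \<le> n" "s \<le> n" for r s
    using interchange_leading_sum[OF assms that] by (auto simp: of_bool_def split: if_splits)
  have less: "leading_sum C j q < leading_sum A j q"
    using interchange_leading_sum[OF assms, of j q] ij by auto
  have "(\<Sum>s\<le>n. leading_sum C j s) < (\<Sum>s\<le>n. leading_sum A j s)"
    using le less ij by (intro sum_strict_mono_ex1) auto
  then show ?thesis unfolding total_leading_sum_def
    using le ij by (intro sum_strict_mono_ex1) (auto intro!: sum_mono)
qed

text \<open>A step of \<open>bruhat_step\<close> may move either end of the comparison, so the induction is on the
  difference of the total leading sums of both.\<close>

lemma bruhat_imp_secondary_small: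
  assumes "k \<le> 2" "A \<in> zero_one_class n k" "C \<in> zero_one_class n k" "bruhat_le n A C"
  shows "secondary_bruhat_le A C"
  using assms(2-4)
proof (induction "total_leading_sum n A - total_leading_sum n C" arbitrary: A C rule: less_induct)
  case less
  show ?case
  proof (cases "A = C")
    case True
    then show ?thesis by (simp add: secondary_bruhat_le_def)
  next
    case False
    have cC: "C \<in> carrier_mat n n" using less.prems by (simp add: zero_one_class_def)
    from bruhat_step[OF less.prems(1,2) assms(1) less.prems(3) False]
    obtain i j p q where "(\<exists>C'. interchange_at n i j p q C C' \<and> bruhat_le n A C') \<or>
      (\<exists>A'. interchange_at n i j p q A' A \<and> bruhat_le n A' C)" by blast
    then show ?thesis
    proof (elim disjE exE conjE)
      fix C' assume C': "interchange_at n i j p q C C'" "bruhat_le n A C'"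
      have "secondary_bruhat_le A C'"
        using less.prems C' interchange_class_forward total_leading_sum_interchange[OF C'(1)]
          total_leading_sum_mono[OF C'(2)]
        by (intro less.hyps) (auto intro: diff_less_mono2)
      moreover have "L2_I2_interchange C C'" using interchange_at_iff cC C' by blast
      ultimately show ?thesis
        unfolding secondary_bruhat_le_def by (rule converse_rtranclp_into_rtranclp[rotated])
    next
      fix A' assume A': "interchange_at n i j p q A' A" "bruhat_le n A' C"
      have class_carrier: "A' \<in> carrier_mat n n"
        using A'(1) by (simp add: interchange_at_def)
      have "secondary_bruhat_le A' C"
        using less.prems A' interchange_class_backward total_leading_sum_interchange[OF A'(1)]
          total_leading_sum_mono[OF A'(2)]
        by (intro less.hyps) (auto intro: diff_less_mono)
      moreover have "L2_I2_interchange A' A"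
        using interchange_at_iff[of A' n A] A' class_carrier by blast
      ultimately show ?thesis
        unfolding secondary_bruhat_le_def by (rule rtranclp.rtrancl_into_rtrancl)
    qed
  qed
qed

lemma coincide_if_le_2: "k \<le> 2 \<Longrightarrow> bruhat_orders_coincide n k"
  unfolding bruhat_orders_coincide_def
  by (intro ballI iffI bruhat_imp_secondary_small) (auto dest: secondary_imp_bruhat)

section \<open>Complementation\<close>

definition complement :: "nat \<Rightarrow> nat mat \<Rightarrow> nat mat" where
  "complement n A = mat n n (\<lambda>rc. 1 - A $$ rc)"

lemma entry_complement:
  assumes "A \<in> zero_one_class n k" "r < n" "s < n"
  shows "entry (complement n A) r s = 1 - entry A r s"
proof -
  have "A $$ (r, s) \<in> {0, 1}" using assms unfolding zero_one_class_def by blast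
  then show ?thesis using assms by (auto simp: complement_def)
qed

lemma complement_carrier: "complement n A \<in> carrier_mat n n"
  by (simp add: complement_def)

lemma complement_class:
  assumes A: "A \<in> zero_one_class n k" and "k \<le> n"
  shows "complement n A \<in> zero_one_class n (n - k)"
proof -
  have "entry (complement n A) r s \<in> {0, 1}" if "r < n" "s < n" for r s
    using entry_complement[OF A that] A that by (auto simp: zero_one_class_int)
  moreover have "(\<Sum>s<n. entry (complement n A) r s) = int (n - k)" if "r < n" for r
    using entry_complement[OF A that] A that \<open>k \<le> n\<close>
    by (simp add: sum_subtractf zero_one_class_int of_nat_diff)
  moreover have "(\<Sum>r<n. entry (complement n A) r s) = int (n - k)" if "s < n" for s
    using entry_complement[OF A _ that] A that \<open>k \<le> n\<close>
    by (simp add: sum_subtractf zero_one_class_int of_nat_diff)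
  ultimately show ?thesis
    unfolding zero_one_class_int using complement_carrier by blast
qed

lemma complement_complement:
  assumes "A \<in> zero_one_class n k"
  shows "complement n (complement n A) = A"
proof (rule eq_matI)
  fix i j assume "i < dim_row A" "j < dim_col A"
  then have ij: "i < n" "j < n" using assms by (auto simp: zero_one_class_def)
  then have "A $$ (i, j) \<in> {0, 1}" using assms unfolding zero_one_class_def by blast
  then show "complement n (complement n A) $$ (i, j) = A $$ (i, j)"
    using ij by (auto simp: complement_def)
qed (use assms in \<open>auto simp: complement_def zero_one_class_def\<close>)

lemma leading_sum_complement:
  assumes A: "A \<in> zero_one_class n k" and "i \<le> n" "j \<le> n"
  shows "int (leading_sum (complement n A) i j) = int i * int j - int (leading_sum A i j)"
proof -
  have "psum (entry (complement n A)) i j = psum (\<lambda>r s. 1 - entry A r s) i j"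
    using assms entry_complement[OF A] by (intro psum_cong) auto
  then show ?thesis by (simp add: leading_sum_psum) (simp add: psum_def sum_subtractf)
qed

lemma bruhat_le_complement:
  assumes "A \<in> zero_one_class n k" "C \<in> zero_one_class n k" "bruhat_le n A C"
  shows "bruhat_le n (complement n C) (complement n A)"
  unfolding bruhat_le_iff
proof (intro allI impI)
  fix i j assume ij: "i \<le> n" "j \<le> n"
  then have "leading_sum C i j \<le> leading_sum A i j" using assms unfolding bruhat_le_iff by blast
  then show "leading_sum (complement n A) i j \<le> leading_sum (complement n C) i j"
    using leading_sum_complement[OF assms(1) ij] leading_sum_complement[OF assms(2) ij] by linarith
qed

lemma interchange_complement:
  assumes "C \<in> zero_one_class n k" "L2_I2_interchange C A"
  shows "L2_I2_interchange (complement n A) (complement n C)"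
proof -
  have "C \<in> carrier_mat n n" using assms by (simp add: zero_one_class_def)
  then obtain i j p q where i: "interchange_at n i j p q C A"
    using assms interchange_at_iff by blast
  have A: "A \<in> zero_one_class n k" using interchange_class_forward i assms by blast
  have "interchange_at n i j p q (complement n A) (complement n C)"
    using interchange_atD[OF i] i entry_complement[OF A] entry_complement[OF assms(1)]
    unfolding interchange_at_def has_L2_def has_I2_def by (auto simp: complement_carrier)
  then show ?thesis using interchange_at_iff complement_carrier by blast
qed

lemma secondary_complement:
  assumes "C \<in> zero_one_class n k" "secondary_bruhat_le A C"
  shows "secondary_bruhat_le (complement n C) (complement n A)"
  using assms(2) unfolding secondary_bruhat_le_def
proof (induction rule: rtranclp_induct)
  case (step B A)
  have "B \<in> zero_one_class n k"
    using secondary_imp_bruhat[OF assms(1)] step.hyps unfolding secondary_bruhat_le_def by blast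
  then have "L2_I2_interchange (complement n A) (complement n B)"
    using interchange_complement step.hyps by blast
  then show ?case using step.IH by (rule converse_rtranclp_into_rtranclp)
qed simp

text \<open>Complementation maps an \<open>L2 \<rightarrow> I2\<close> interchange to one in the opposite direction, so both orders on
  the class for \<open>k\<close> are the reversed orders on the class for \<open>n - k\<close>.\<close>

lemma coincide_complement:
  assumes "k \<le> n" "bruhat_orders_coincide n (n - k)"
  shows "bruhat_orders_coincide n k"
  unfolding bruhat_orders_coincide_def
proof (intro ballI iffI)
  fix A C assume A: "A \<in> zero_one_class n k" and C: "C \<in> zero_one_class n k"
  note A' = complement_class[OF A assms(1)] and C' = complement_class[OF C assms(1)]
  show "bruhat_le n A C" if "secondary_bruhat_le A C"
    using secondary_imp_bruhat C that by blast
  show "secondary_bruhat_le A C" if "bruhat_le n A C"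
  proof -
    have "secondary_bruhat_le (complement n C) (complement n A)"
      using assms(2) A' C' bruhat_le_complement[OF A C that]
      unfolding bruhat_orders_coincide_def by blast
    then show ?thesis
      using secondary_complement[OF A'] complement_complement A C by metis
  qed
qed

section \<open>A bad pair of matrices of order \<open>n\<close> for \<open>3 \<le> k \<le> n - 3\<close>\<close>

text \<open>A partial matrix with \<open>r\<close> rows extends to a \<open>k\<close>-regular matrix if no column has too many ones or
  needs more ones than rows remain. The next row must meet every column in which all remaining
  entries have to be ones, and must avoid the columns that are already full. Counting the missing
  ones, \<open>(n - r) * k\<close> in total and at most \<open>n - r\<close> per column, shows that at most \<open>k\<close> columns are
  forced and at least \<open>k\<close> are open, so a choice of \<open>k\<close> columns exists.\<close>

lemma regular_completion:
  fixes T :: "nat \<Rightarrow> nat \<Rightarrow> nat"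
  assumes "r \<le> n"
    and "\<And>p q. p < r \<Longrightarrow> q < n \<Longrightarrow> T p q \<in> {0, 1}"
    and "\<And>p. p < r \<Longrightarrow> (\<Sum>q<n. T p q) = k"
    and "\<And>q. q < n \<Longrightarrow> (\<Sum>p<r. T p q) \<le> k"
    and "\<And>q. q < n \<Longrightarrow> k \<le> (\<Sum>p<r. T p q) + (n - r)"
  shows "\<exists>M\<in>zero_one_class n k. \<forall>p<r. \<forall>q<n. M $$ (p, q) = T p q"
  using assms
proof (induction "n - r" arbitrary: r T)
  case 0
  then have [simp]: "r = n" by simp
  define M where "M = mat n n (\<lambda>(p, q). T p q)"
  have "(\<Sum>p<n. T p q) = k" if "q < n" for q
    using 0(5,6)[OF that] by simp
  then have "M \<in> zero_one_class n k"
    using 0(3,4) by (simp add: M_def zero_one_class_def)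
  then show ?case by (intro bexI[of _ M]) (auto simp: M_def)
next
  case (Suc d)
  note T01 = Suc.prems(2) and row = Suc.prems(3) and col_le = Suc.prems(4) and col_ge = Suc.prems(5)
  have r: "r < n" and d: "n - r = Suc d" using Suc.hyps(2) by auto
  define need where "need q = k - (\<Sum>p<r. T p q)" for q
  have need: "(\<Sum>p<r. T p q) + need q = k" "need q \<le> n - r" if "q < n" for q
    using col_le[OF that] col_ge[OF that] by (auto simp: need_def)
  have "(\<Sum>q<n. \<Sum>p<r. T p q) = r * k"
    using row by (subst sum.swap) simp
  moreover have "(\<Sum>q<n. (\<Sum>p<r. T p q) + need q) = n * k"
    using need by simp
  ultimately have "r * k + (\<Sum>q<n. need q) = n * k" by (simp add: sum.distrib)
  then have total: "(\<Sum>q<n. need q) = (n - r) * k"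
    by (simp add: diff_mult_distrib)
  \<comment> \<open>Forced columns: every remaining row has to contain a one there.\<close>
  define full where "full = {q. q < n \<and> need q = n - r}"
  define open_cols where "open_cols = {q. q < n \<and> 0 < need q}"
  have "(n - r) * card full = (\<Sum>q\<in>full. need q)" by (simp add: full_def)
  also have "\<dots> \<le> (\<Sum>q<n. need q)" by (rule sum_mono2) (auto simp: full_def)
  finally have "(n - r) * card full \<le> (n - r) * k" using total by simp
  then have full_card: "card full \<le> k" using r by simp
  have "(\<Sum>q<n. need q) = (\<Sum>q\<in>open_cols. need q)"
    by (rule sum.mono_neutral_right) (auto simp: open_cols_def)
  also have "\<dots> \<le> (\<Sum>q\<in>open_cols. n - r)"
    using need by (intro sum_mono) (auto simp: open_cols_def)
  finally have "(n - r) * k \<le> (n - r) * card open_cols" using total by (simp add: mult.commute)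
  then have "k \<le> card open_cols" using r by simp
  moreover have "full \<subseteq> open_cols" "finite open_cols"
    using r by (auto simp: full_def open_cols_def)
  ultimately obtain S where S: "full \<subseteq> S" "S \<subseteq> open_cols" "card S = k"
    using full_card exists_subset_between[of full k open_cols] by blast
  define T' where "T' = T(r := \<lambda>q. of_bool (q \<in> S))"
  have cols: "(\<Sum>p<Suc r. T' p q) = (\<Sum>p<r. T p q) + of_bool (q \<in> S)" for q
    by (simp add: T'_def)
  have Sn: "S \<subseteq> {..<n}" using S by (auto simp: open_cols_def)
  have "\<exists>M\<in>zero_one_class n k. \<forall>p<Suc r. \<forall>q<n. M $$ (p, q) = T' p q"
  proof (rule Suc.hyps(1))
    show "d = n - Suc r" "Suc r \<le> n" using d r by auto
    show "T' p q \<in> {0, 1}" if "p < Suc r" "q < n" for p q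
      using that T01 by (auto simp: T'_def less_Suc_eq)
    show "(\<Sum>q<n. T' p q) = k" if "p < Suc r" for p
    proof (cases "p = r")
      case True
      then show ?thesis using S Sn by (simp add: T'_def of_bool_def sum.If_cases Int_absorb1)
    next
      case False
      then show ?thesis using that row by (simp add: T'_def)
    qed
    fix q assume q: "q < n"
    have "q \<in> S \<Longrightarrow> 0 < need q" using S(2) by (auto simp: open_cols_def)
    then show "(\<Sum>p<Suc r. T' p q) \<le> k"
      unfolding cols using need(1)[OF q] by (cases "q \<in> S") auto
    have "q \<notin> S \<Longrightarrow> need q \<noteq> n - r" using S(1) q by (auto simp: full_def)
    then show "k \<le> (\<Sum>p<Suc r. T' p q) + (n - Suc r)"
      unfolding cols using need[OF q] d by (cases "q \<in> S") auto
  qed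
  then obtain M where "M \<in> zero_one_class n k"
    and M: "\<And>p q. p < Suc r \<Longrightarrow> q < n \<Longrightarrow> M $$ (p, q) = T' p q" by blast
  moreover have "M $$ (p, q) = T p q" if "p < r" "q < n" for p q
    using M[of p q] that by (simp add: T'_def)
  ultimately show ?case by blast
qed

text \<open>The fixed \<open>4 \<times> 4\<close> block has row sums 1, 3, 3, 1; each row is filled up to the sum \<open>k\<close> with a run of
  ones that starts in column 4.\<close>

definition top_rows :: "nat \<Rightarrow> nat \<Rightarrow> nat \<Rightarrow> nat" where
  "top_rows k p q =
     (if q < 4 then [[0,0,0,1], [1,1,0,1], [1,0,1,1], [1,0,0,0]] ! p ! q
      else of_bool (q < 4 + (if p \<in> {0, 3} then k - 1 else k - 3)))"

lemma sum_lessThan_4: "(\<Sum>q<4. g q) = g 0 + g 1 + g 2 + (g (3::nat) :: 'a::comm_monoid_add)"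
  by (simp add: eval_nat_numeral add.assoc)

text \<open>The block has column sums 3, 1, 1, 3, within the bounds \<open>k\<close> and \<open>k - (n - 4) \<le> 1\<close>. A later column
  has at most \<open>2\<close> ones if \<open>k = 3\<close> and at most \<open>4 \<le> k\<close> ones otherwise; a one is required there only if
  \<open>k = n - 3\<close>, and then the runs in rows 0 and 3 reach every column.\<close>

lemma top_rows_completion:
  assumes k: "3 \<le> k" "k + 3 \<le> n"
  shows "\<exists>C\<in>zero_one_class n k. \<forall>p<4. \<forall>q<4. C $$ (p, q) = top_rows k p q"
proof -
  have p4: "p = 0 \<or> p = 1 \<or> p = 2 \<or> p = 3" if "p < 4" for p :: nat using that by auto
  have "\<exists>M\<in>zero_one_class n k. \<forall>p<4. \<forall>q<n. M $$ (p, q) = top_rows k p q"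
  proof (rule regular_completion)
    show "4 \<le> n" using k by simp
    show "top_rows k p q \<in> {0, 1}" if "p < 4" for p q
    proof (cases "q < 4")
      case True
      then show ?thesis
        using p4[OF \<open>p < 4\<close>] p4[OF True] by (elim disjE) (simp_all add: top_rows_def)
    qed (simp add: top_rows_def)
    show "(\<Sum>q<n. top_rows k p q) = k" if "p < 4" for p
    proof -
      define l where "l = (if p \<in> {0, 3} then k - 1 else k - 3)"
      have "l + 4 \<le> n" using k by (auto simp: l_def)
      have "{..<n} = {..<4} \<union> {4..<n}" using k by auto
      then have "(\<Sum>q<n. top_rows k p q)
          = (\<Sum>q<4. top_rows k p q) + (\<Sum>q\<in>{4..<n}. top_rows k p q)"
        by (simp add: sum.union_disjoint ivl_disj_int)
      also have "(\<Sum>q\<in>{4..<n}. top_rows k p q) = (\<Sum>q\<in>{4..<n}. of_bool (q < 4 + l))"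
        unfolding top_rows_def l_def by (intro sum.cong) auto
      also have "\<dots> = (\<Sum>q\<in>{4..<4 + l}. 1)"
        using \<open>l + 4 \<le> n\<close> by (intro sum.mono_neutral_cong_right) auto
      also have "\<dots> = l" by simp
      finally show ?thesis
        using p4[OF that] k by (elim disjE) (simp_all add: sum_lessThan_4 top_rows_def l_def)
    qed
    fix q assume "q < n"
    show "(\<Sum>p<4. top_rows k p q) \<le> k"
    proof (cases "q < 4")
      case True
      show ?thesis
        using p4[OF True] k by (elim disjE) (simp_all add: sum_lessThan_4 top_rows_def)
    next
      case False
      then show ?thesis using k by (auto simp: sum_lessThan_4 top_rows_def)
    qed
    show "k \<le> (\<Sum>p<4. top_rows k p q) + (n - 4)"
    proof (cases "q < 4")
      case True
      show ?thesis
        using p4[OF True] k by (elim disjE) (simp_all add: sum_lessThan_4 top_rows_def)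
    next
      case False
      then show ?thesis using k \<open>q < n\<close> by (auto simp: sum_lessThan_4 top_rows_def)
    qed
  qed
  then obtain M where "M \<in> zero_one_class n k"
    "\<And>p q. p < 4 \<Longrightarrow> q < n \<Longrightarrow> M $$ (p, q) = top_rows k p q" by blast
  then show ?thesis using k by (intro bexI[of _ M]) auto
qed

text \<open>A chain of interchanges from \<open>C\<close> to \<open>A\<close> would begin with an \<open>L2\<close> of \<open>C\<close> whose rectangle lies in the
  ring where the leading sums of \<open>A\<close> and \<open>C\<close> differ. This confines it to the leading \<open>4 \<times> 4\<close> block
  and forbids it to contain the centre, which leaves finitely many positions to inspect.\<close>

lemma not_coincide:
  assumes k: "3 \<le> k" "k + 3 \<le> n"
  shows "\<not> bruhat_orders_coincide n k"
proof
  assume co: "bruhat_orders_coincide n k"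
  obtain C where C: "C \<in> zero_one_class n k"
    and top: "\<And>p q. p < 4 \<Longrightarrow> q < 4 \<Longrightarrow> C $$ (p, q) = top_rows k p q"
    using top_rows_completion[OF k] by blast
  have cC: "C \<in> carrier_mat n n" using C by (simp add: zero_one_class_def)
  have vals: "C $$ (0,0) = 0" "C $$ (0,1) = 0" "C $$ (0,2) = 0" "C $$ (0,3) = 1"
    "C $$ (1,0) = 1" "C $$ (1,1) = 1" "C $$ (1,2) = 0" "C $$ (1,3) = 1"
    "C $$ (2,0) = 1" "C $$ (2,1) = 0" "C $$ (2,2) = 1" "C $$ (2,3) = 1"
    "C $$ (3,0) = 1" "C $$ (3,1) = 0" "C $$ (3,2) = 0" "C $$ (3,3) = 0"
    by (simp_all add: top top_rows_def)
  have n: "6 \<le> n" using k by simp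
  obtain B where B: "interchange_at n 0 3 0 3 C B"
    using interchange_up_exists[OF cC, of 0 3 0 3] n vals by (auto simp: has_L2_def)
  then have cB: "B \<in> carrier_mat n n"
    and eqB: "\<And>r s. r < n \<Longrightarrow> s < n \<Longrightarrow> entry B r s = entry C r s + bump 0 3 r * bump 0 3 s"
    by (auto simp: interchange_at_def)
  have "has_I2 (entry B) 1 2 1 2"
    using n vals by (simp add: has_I2_def eqB bump_def)
  then obtain A where A: "interchange_at n 1 2 1 2 A B"
    using interchange_down_exists[OF cB, of 1 2 1 2] n by auto
  have clA: "A \<in> zero_one_class n k"
    using interchange_class_backward[OF A] interchange_class_forward[OF B C] by blast
  have diff: "int (leading_sum A r s) = int (leading_sum C r s)
      + of_bool (0 < r \<and> r \<le> 3 \<and> 0 < s \<and> s \<le> 3) - of_bool (r = 2 \<and> s = 2)"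
    if "r \<le> n" "s \<le> n" for r s
  proof -
    have "(1 < r \<and> r \<le> 2 \<and> 1 < s \<and> s \<le> 2) = (r = 2 \<and> s = 2)" by auto
    then show ?thesis
      using interchange_leading_sum[OF A that] interchange_leading_sum[OF B that] by simp
  qed
  have "leading_sum C r s \<le> leading_sum A r s" if "r \<le> n" "s \<le> n" for r s
    using diff[OF that]
    by (cases "r = 2 \<and> s = 2") (auto simp: of_bool_def split: if_splits)
  then have "bruhat_le n A C" by (simp add: bruhat_le_iff)
  then have "L2_I2_interchange\<^sup>*\<^sup>* C A"
    using co clA C unfolding bruhat_orders_coincide_def secondary_bruhat_le_def by blast
  moreover have "C \<noteq> A" using diff[of 1 1] n by auto
  ultimately obtain D where D: "L2_I2_interchange C D" "L2_I2_interchange\<^sup>*\<^sup>* D A"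
    by (metis converse_rtranclpE)
  then obtain i j p q where i: "interchange_at n i j p q C D"
    using interchange_at_iff[OF cC] by blast
  have ij: "i < j" "j < n" "p < q" "q < n" and L2: "has_L2 (entry C) i j p q"
    using i by (auto simp: interchange_at_def)
  have "bruhat_le n A D"
    using secondary_imp_bruhat[OF interchange_class_forward[OF i C]] D(2)
    by (simp add: secondary_bruhat_le_def)
  then have inside: "r \<le> 3 \<and> s \<le> 3 \<and> \<not> (r = 2 \<and> s = 2)"
    if "i < r" "r \<le> j" "p < s" "s \<le> q" for r s
  proof -
    have "leading_sum D r s \<le> leading_sum A r s"
      using \<open>bruhat_le n A D\<close> that ij by (simp add: bruhat_le_iff)
    moreover have "int (leading_sum D r s) = int (leading_sum C r s) + 1"
      using interchange_leading_sum[OF i, of r s] that ij by simp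
    ultimately show ?thesis
      using diff[of r s] that ij by (cases "r \<le> 3 \<and> s \<le> 3"; cases "r = 2 \<and> s = 2") auto
  qed
  have "j \<le> 3" "q \<le> 3" using inside[of j q] ij by auto
  then have "j = 1 \<or> j = 2 \<or> j = 3" "q = 1 \<or> q = 2 \<or> q = 3"
    "i = 0 \<or> i = 1 \<or> i = 2" "p = 0 \<or> p = 1 \<or> p = 2"
    using ij by auto
  moreover have "\<not> (i < 2 \<and> 2 \<le> j \<and> p < 2 \<and> 2 \<le> q)" using inside[of 2 2] by auto
  ultimately show False
    using L2 ij(1,3) vals unfolding has_L2_def by (elim disjE) simp_all
qed

section \<open>The characterization\<close>

theorem theorem2p7:
  fixes n k :: nat
  assumes "k \<le> n"
  shows "bruhat_orders_coincide n k \<longleftrightarrow>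
    (0 \<le> n \<and> n \<le> 5) \<or> (n \<ge> 6 \<and> k \<in> {0, 1, 2, n - 2, n - 1, n})"
proof -
  have "bruhat_orders_coincide n k \<longleftrightarrow> k \<le> 2 \<or> n - k \<le> 2"
    using coincide_if_le_2 coincide_complement[OF assms] not_coincide[of k n] assms by fastforce
  also have "\<dots> \<longleftrightarrow> (0 \<le> n \<and> n \<le> 5) \<or> (n \<ge> 6 \<and> k \<in> {0, 1, 2, n - 2, n - 1, n})"
    using assms by auto
  finally show ?thesis .
qed

end
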